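(* Let $(V,* )$ be a finite travel groupoid. Then the following statements are equivalent: (1) $(V,* )$ is on a complete multipartite graph (i.e. its associated graph $G_V$ is a complete multipartite graph); (2) for all pairwise distinct $u,v,w\in V$, if $v*w=w$, then $v*u=u$ or $w*u=u$.
   Context: A groupoid $(V,* )$ is a nonempty set $V$ with a binary operation $*:V\times V\to V$. It is a travel groupoid if (t1) $(u*v)*u=u$ for all $u,v\in V$, and (t2) for all $u,v\in V$, if $(u*v)*v=u$ then $u=v$. The associated graph $G_V$ of a travel groupoid has vertex set $V$ and edge set $\{\{u,v\} : u,v\in V,\ u\neq u*v=v\}$; $(V,* )$ is said to be on a graph $G$ if $G=G_V$. Graphs are finite, undirected, with no multiple edges or loops. A complete multipartite graph with $l$ parts is a graph whose vertex set is partitioned into $l\ge 1$ nonempty independent sets $V_1,\dots,V_l$, with an edge between every pair of vertices from different independent sets (edgeless graphs, $l=1$, and complete graphs, all parts singletons, are included). *)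

theory Defs
  imports Main "HOL-Library.Disjoint_Sets"
begin

text \<open>A groupoid is given by a carrier \<open>V\<close> and an operation that is only constrained on \<open>V\<close>.\<close>

locale groupoid =
  fixes V :: "'a set" and star :: "'a \<Rightarrow> 'a \<Rightarrow> 'a"  (infixl "\<star>" 70)
  assumes nonempty: "V \<noteq> {}"
    and closed: "\<And>u v. u \<in> V \<Longrightarrow> v \<in> V \<Longrightarrow> u \<star> v \<in> V"

locale travel_groupoid = groupoid +
  assumes t1: "\<And>u v. u \<in> V \<Longrightarrow> v \<in> V \<Longrightarrow> (u \<star> v) \<star> u = u"
    and t2: "\<And>u v. u \<in> V \<Longrightarrow> v \<in> V \<Longrightarrow> (u \<star> v) \<star> v = u \<Longrightarrow> u = v"

record 'a ugraph =
  vertices :: "'a set"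
  edges :: "'a set set"

definition finite_simple_graph :: "'a ugraph \<Rightarrow> bool" where
  "finite_simple_graph G \<longleftrightarrow>
     finite (vertices G) \<and> (\<forall>e \<in> edges G. e \<subseteq> vertices G \<and> card e = 2)"

definition independent_set :: "'a ugraph \<Rightarrow> 'a set \<Rightarrow> bool" where
  "independent_set G A \<longleftrightarrow> A \<subseteq> vertices G \<and> (\<forall>x \<in> A. \<forall>y \<in> A. {x, y} \<notin> edges G)"

text \<open>The parts are nonempty and pairwise disjoint by the definition of \<^const>\<open>partition_on\<close>.\<close>

definition complete_multipartite_parts :: "nat \<Rightarrow> 'a ugraph \<Rightarrow> bool" where
  "complete_multipartite_parts l G \<longleftrightarrow> finite_simple_graph G \<and>
     (\<exists>P. partition_on (vertices G) P \<and> finite P \<and> card P = l \<and>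
          (\<forall>A \<in> P. independent_set G A) \<and>
          (\<forall>A \<in> P. \<forall>B \<in> P. A \<noteq> B \<longrightarrow> (\<forall>x \<in> A. \<forall>y \<in> B. {x, y} \<in> edges G)))"

definition complete_multipartite :: "'a ugraph \<Rightarrow> bool" where
  "complete_multipartite G \<longleftrightarrow> (\<exists>l \<ge> 1. complete_multipartite_parts l G)"

definition associated_graph :: "'a set \<Rightarrow> ('a \<Rightarrow> 'a \<Rightarrow> 'a) \<Rightarrow> 'a ugraph" where
  "associated_graph V star =
     \<lparr> vertices = V,
       edges = {{u, v} | u v. u \<in> V \<and> v \<in> V \<and> u \<noteq> star u v \<and> star u v = v} \<rparr>"

definition on_graph :: "'a set \<Rightarrow> ('a \<Rightarrow> 'a \<Rightarrow> 'a) \<Rightarrow> 'a ugraph \<Rightarrow> bool" where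
  "on_graph V star G \<longleftrightarrow> G = associated_graph V star"

end

theory Submission
  imports Defs
begin

text \<open>A finite loopless graph on a nonempty vertex set is complete multipartite exactly when
  non-adjacency is transitive, that is, when every vertex is adjacent to at least one end of each
  edge not containing it (\<open>complete_multipartite_iff\<close>). In a travel groupoid, adjacency
  of distinct \<open>u\<close>, \<open>v\<close> is the equation \<open>u \<star> v = v\<close>,
  whichever way round the pair is read (\<open>edge_associated_graph_iff\<close>). Under this
  translation the graph condition becomes the condition on triples.\<close>

lemma finite_simple_graph_no_loop:
  assumes "finite_simple_graph G"
  shows "{x} \<notin> edges G"
  using assms by (force simp: finite_simple_graph_def)

text \<open>The right-hand side is the contrapositive of transitivity of non-adjacency. Non-adjacency is
  then an equivalence relation, and the parts are its classes.\<close>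

lemma complete_multipartite_iff:
  assumes G: "finite_simple_graph G" and ne: "vertices G \<noteq> {}"
  shows "complete_multipartite G \<longleftrightarrow>
    (\<forall>u \<in> vertices G. \<forall>v \<in> vertices G. \<forall>w \<in> vertices G.
       {v, w} \<in> edges G \<longrightarrow> {v, u} \<in> edges G \<or> {w, u} \<in> edges G)"
proof
  assume "complete_multipartite G"
  then obtain P where P: "partition_on (vertices G) P"
    and indep: "\<forall>A \<in> P. independent_set G A"
    and complete: "\<forall>A \<in> P. \<forall>B \<in> P. A \<noteq> B \<longrightarrow> (\<forall>x \<in> A. \<forall>y \<in> B. {x, y} \<in> edges G)"
    by (auto simp: complete_multipartite_def complete_multipartite_parts_def)
  show "\<forall>u \<in> vertices G. \<forall>v \<in> vertices G. \<forall>w \<in> vertices G.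
       {v, w} \<in> edges G \<longrightarrow> {v, u} \<in> edges G \<or> {w, u} \<in> edges G"
  proof (intro ballI impI)
    fix u v w
    assume "u \<in> vertices G" "v \<in> vertices G" "w \<in> vertices G" and vw: "{v, w} \<in> edges G"
    then obtain A B C where parts: "A \<in> P" "B \<in> P" "C \<in> P" "u \<in> A" "v \<in> B" "w \<in> C"
      using partition_onD1[OF P] by (metis UnionE)
    have "B \<noteq> C"
      using indep parts vw by (auto simp: independent_set_def)
    \<comment> \<open>Since \<open>B\<close> and \<open>C\<close> differ, the part \<open>A\<close>
      of \<open>u\<close> differs from at least one of them.\<close>
    then show "{v, u} \<in> edges G \<or> {w, u} \<in> edges G"
      using complete parts by metis
  qed
next
  assume trans: "\<forall>u \<in> vertices G. \<forall>v \<in> vertices G. \<forall>w \<in> vertices G.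
       {v, w} \<in> edges G \<longrightarrow> {v, u} \<in> edges G \<or> {w, u} \<in> edges G"
  define r where "r = {(x, y) \<in> vertices G \<times> vertices G. {x, y} \<notin> edges G}"
  have eq: "equiv (vertices G) r"
  proof (rule equivI)
    show "r \<subseteq> vertices G \<times> vertices G"
      by (auto simp: r_def)
    \<comment> \<open>Reflexivity of non-adjacency is the absence of loops, because
      \<open>{x, x}\<close> is \<open>{x}\<close>.\<close>
    show "refl_on (vertices G) r"
      using finite_simple_graph_no_loop[OF G] by (simp add: refl_on_def r_def)
    show "sym r"
      by (simp add: sym_def r_def insert_commute)
    show "trans r"
      unfolding trans_def
    proof (intro allI impI)
      fix x y z assume "(x, y) \<in> r" "(y, z) \<in> r"
      then show "(x, z) \<in> r"
        \<comment> \<open>The middle vertex \<open>y\<close> is tested against a supposed edge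
          \<open>{x, z}\<close>: it would be adjacent to \<open>x\<close> or to
          \<open>z\<close>.\<close>
        using trans[rule_format, of y x z] by (auto simp: r_def insert_commute)
    qed
  qed
  define P where "P = vertices G // r"
  have part: "partition_on (vertices G) P"
    unfolding P_def by (rule partition_on_quotient[OF eq])
  have fin: "finite P"
    using finite_elements[OF _ part] G by (simp add: finite_simple_graph_def)
  \<comment> \<open>The bound \<open>l \<ge> 1\<close> on the number of parts comes from the
    nonempty vertex set.\<close>
  have "P \<noteq> {}"
    using ne partition_onD1[OF part] by auto
  then have "1 \<le> card P"
    using fin by (simp add: Suc_le_eq card_gt_0_iff)
  have "independent_set G A" if "A \<in> P" for A
    unfolding independent_set_def
  proof (intro conjI ballI)
    show "A \<subseteq> vertices G"
      using that partition_onD1[OF part] by blast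
    fix x y assume "x \<in> A" "y \<in> A"
    then have "(x, y) \<in> r"
      using that quotient_eq_iff[OF eq, of A A x y] by (simp add: P_def)
    then show "{x, y} \<notin> edges G"
      by (simp add: r_def)
  qed
  moreover have "{x, y} \<in> edges G"
    if "A \<in> P" "B \<in> P" "A \<noteq> B" "x \<in> A" "y \<in> B" for A B x y
  proof -
    have "x \<in> vertices G" "y \<in> vertices G"
      using that partition_onD1[OF part] by blast+
    moreover have "(x, y) \<notin> r"
      using that quotient_eq_iff[OF eq, of A B x y] by (simp add: P_def)
    ultimately show ?thesis
      by (simp add: r_def)
  qed
  ultimately have "complete_multipartite_parts (card P) G"
    unfolding complete_multipartite_parts_def using G part fin by (intro conjI exI[of _ P]) simp_all
  with \<open>1 \<le> card P\<close> show "complete_multipartite G"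
    unfolding complete_multipartite_def by blast
qed

lemma finite_simple_graph_associated_graph:
  assumes "finite V"
  shows "finite_simple_graph (associated_graph V f)"
  using assms by (auto simp: finite_simple_graph_def associated_graph_def card_insert_if)

context travel_groupoid
begin

text \<open>Replacing \<open>u \<star> v\<close> by \<open>v\<close> in \<open>t1\<close> gives the
  claim. It makes the orientation of an edge irrelevant.\<close>

lemma star_eq_right_sym:
  assumes "u \<in> V" "v \<in> V" "u \<star> v = v"
  shows "v \<star> u = u"
  using t1[of u v] assms by simp

text \<open>An unordered edge may stem from the pair \<open>(u, v)\<close> or from
  \<open>(v, u)\<close>; \<open>star_eq_right_sym\<close> turns the second case into the
  first.\<close>

lemma edge_associated_graph_iff:
  assumes "u \<in> V" "v \<in> V"
  shows "{u, v} \<in> edges (associated_graph V (\<star>)) \<longleftrightarrow> u \<noteq> v \<and> u \<star> v = v"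
proof
  assume "{u, v} \<in> edges (associated_graph V (\<star>))"
  then obtain x y where "x \<noteq> y" "x \<star> y = y" and uv: "u = x \<and> v = y \<or> u = y \<and> v = x"
    unfolding associated_graph_def by (auto simp: doubleton_eq_iff)
  then show "u \<noteq> v \<and> u \<star> v = v"
    using assms star_eq_right_sym by blast
next
  assume "u \<noteq> v \<and> u \<star> v = v"
  then show "{u, v} \<in> edges (associated_graph V (\<star>))"
    using assms unfolding associated_graph_def by force
qed

end

theorem theorem3p2:
  fixes V :: "'a set" and star :: "'a \<Rightarrow> 'a \<Rightarrow> 'a"  (infixl "\<star>" 70)
  assumes "travel_groupoid V (\<star>)"
    and "finite V"
  shows "(\<exists>G. complete_multipartite G \<and> on_graph V (\<star>) G) \<longleftrightarrow>
    (\<forall>u \<in> V. \<forall>v \<in> V. \<forall>w \<in> V. u \<noteq> v \<and> v \<noteq> w \<and> u \<noteq> w \<longrightarrow>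
       v \<star> w = w \<longrightarrow> v \<star> u = u \<or> w \<star> u = u)"
proof -
  interpret travel_groupoid V star by fact
  let ?G = "associated_graph V (\<star>)"
  have V: "vertices ?G = V"
    by (simp add: associated_graph_def)
  have "(\<exists>G. complete_multipartite G \<and> on_graph V (\<star>) G) \<longleftrightarrow> complete_multipartite ?G"
    by (simp add: on_graph_def)
  also have "\<dots> \<longleftrightarrow> (\<forall>u \<in> V. \<forall>v \<in> V. \<forall>w \<in> V.
      {v, w} \<in> edges ?G \<longrightarrow> {v, u} \<in> edges ?G \<or> {w, u} \<in> edges ?G)"
    using complete_multipartite_iff[OF finite_simple_graph_associated_graph[OF \<open>finite V\<close>], of star]
      nonempty by (simp add: V)
  also have "\<dots> \<longleftrightarrow> (\<forall>u \<in> V. \<forall>v \<in> V. \<forall>w \<in> V. v \<noteq> w \<and> v \<star> w = w \<longrightarrow>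
      v \<noteq> u \<and> v \<star> u = u \<or> w \<noteq> u \<and> w \<star> u = u)"
    by (simp add: edge_associated_graph_iff)
  also have "\<dots> \<longleftrightarrow> (\<forall>u \<in> V. \<forall>v \<in> V. \<forall>w \<in> V. u \<noteq> v \<and> v \<noteq> w \<and> u \<noteq> w \<longrightarrow>
       v \<star> w = w \<longrightarrow> v \<star> u = u \<or> w \<star> u = u)"
    \<comment> \<open>Triples with \<open>u = v\<close> or \<open>u = w\<close> add nothing: for
      \<open>u = w\<close> the first disjunct is the premise itself, and for \<open>u = v\<close>
      the second is the premise reversed by symmetry.\<close>
    using star_eq_right_sym by (intro ball_cong refl) metis
  finally show ?thesis .
qed

end
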